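(* Let $n\ge2$ be an integer. The $\circ_n$-irreducible elements of $n\mathrm{Ell}(\mathbb{Z})$ agree with the $\circ_n$-prime elements of $n\mathrm{Ell}(\mathbb{Z})$ if and only if $(\mathbb{Z}/(n+1)\mathbb{Z})^{\times}\cong\{\pm1\}$.
   Context: $n\mathrm{Ell}(\mathbb{Z})$ is the set $\mathbb{Z}$ with the $n$-ary operation $a_1\ast\cdots\ast a_n:=1-\sum_{i=1}^n a_i$ and the commutative monoid operation $a\circ_n b:=a+b-(n+1)ab$ with identity $0$. Units are taken with respect to $\circ_n$. We write $p\mid_n a$ if $a=p\circ_n r$ for some $r\in\mathbb{Z}$. A non-unit $p$ is $\circ_n$-prime if $p\mid_n a\circ_n b$ implies $p\mid_n a$ or $p\mid_n b$; a non-unit $p$ is $\circ_n$-irreducible if $p=a\circ_n b$ implies that $a$ or $b$ is a $\circ_n$-unit. *)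

theory Defs
  imports "HOL-Number_Theory.Residues" "HOL-Algebra.Divisibility" "HOL-Algebra.Sym_Groups"
begin

text \<open>The arguments of the \<open>n\<close>-ary operation are the values \<open>a 1, \<dots>, a n\<close> of a function
  on the naturals.\<close>

record 'a nary_monoid = "'a monoid" +
  nary :: "(nat \<Rightarrow> 'a) \<Rightarrow> 'a"

definition nEll :: "nat \<Rightarrow> int nary_monoid" where
  "nEll n = \<lparr>carrier = UNIV,
     monoid.mult = (\<lambda>a b. a + b - (int n + 1) * a * b),
     one = 0,
     nary = (\<lambda>a. 1 - (\<Sum>i = 1..n. a i))\<rparr>"

lemma nEll_comm_monoid: "comm_monoid (nEll n)"
  by (rule comm_monoidI) (auto simp: nEll_def algebra_simps)

text \<open>\<open>Divisibility.irreducible\<close> is phrased through proper divisors; this is the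
  formulation through factorizations into two factors.\<close>

definition factor_irreducible :: "('a, 'b) monoid_scheme \<Rightarrow> 'a \<Rightarrow> bool" where
  "factor_irreducible G p \<longleftrightarrow> p \<in> carrier G \<and> p \<notin> Units G \<and>
     (\<forall>a \<in> carrier G. \<forall>b \<in> carrier G.
        p = a \<otimes>\<^bsub>G\<^esub> b \<longrightarrow> a \<in> Units G \<or> b \<in> Units G)"

end

theory Submission
  imports Defs
begin

text \<open>
  Put \<open>m = n + 1\<close>, so \<open>m \<ge> 3\<close>. Since \<open>1 - m (a + b - m a b) = (1 - m a) (1 - m b)\<close>, the map
  \<open>a \<mapsto> 1 - m a\<close> identifies the monoid \<open>\<circ>\<^sub>n\<close> with the multiplicative monoid of the integers
  \<open>x \<equiv> 1 (mod m)\<close>. Its only unit is \<open>1\<close>, because \<open>-1 \<equiv> 1\<close> fails modulo \<open>m\<close>, and its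
  divisibility is that of the integers, because the cofactor of an element in a multiple lying in
  the monoid is again congruent to \<open>1\<close>. Primes are therefore irreducible by cancellation, and the
  question is when irreducibles are prime.

  If every integer coprime to \<open>m\<close> is \<open>\<plusminus>1\<close> modulo \<open>m\<close>, then an integer factorization of an
  element of the monoid becomes a factorization inside the monoid after changing both signs if
  necessary. So irreducible elements are irreducible integers, hence prime integers
  (\<open>one_mod_irreducible_imp_prime\<close>).

  Otherwise some prime \<open>p\<close> not dividing \<open>m\<close> is not \<open>\<plusminus>1\<close> modulo \<open>m\<close>, as products of numbers
  \<open>\<equiv> \<plusminus>1\<close> are \<open>\<equiv> \<plusminus>1\<close>. Let \<open>k\<close> be the order of \<open>p\<close> in \<open>(\<int>/m)\<^sup>\<times>/{\<plusminus>1}\<close>; then \<open>k \<ge> 2\<close>, and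
  \<open>x = \<plusminus>p^k\<close>, with the appropriate sign, lies in the monoid and is irreducible by minimality of
  \<open>k\<close>. It is not prime: choose \<open>q\<close> not divisible by \<open>p\<close> with \<open>p q \<equiv> 1 (mod m)\<close>; then \<open>x\<close>
  divides \<open>(p q)^k\<close> but not \<open>p q\<close> (\<open>irreducible_not_prime_exists\<close>).
\<close>

section \<open>The monoid of integers congruent to one\<close>

text \<open>
  Irreducibility and primality in the monoid of integers congruent to \<open>1\<close> modulo \<open>m\<close>, for
  \<open>m \<ge> 3\<close>: there \<open>1\<close> is the only unit, and divisibility in the integers agrees with
  divisibility in the monoid. Membership of \<open>x\<close> in the monoid is left to the lemmas.
\<close>

definition one_mod_irreducible :: "int \<Rightarrow> int \<Rightarrow> bool" where
  "one_mod_irreducible m x \<longleftrightarrow> x \<noteq> 1 \<and>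
     (\<forall>a b. [a = 1] (mod m) \<longrightarrow> [b = 1] (mod m) \<longrightarrow> x = a * b \<longrightarrow> a = 1 \<or> b = 1)"

definition one_mod_prime :: "int \<Rightarrow> int \<Rightarrow> bool" where
  "one_mod_prime m x \<longleftrightarrow> x \<noteq> 1 \<and>
     (\<forall>a b. [a = 1] (mod m) \<longrightarrow> [b = 1] (mod m) \<longrightarrow> x dvd a * b \<longrightarrow> x dvd a \<or> x dvd b)"

text \<open>This is why divisibility in the monoid is divisibility of integers.\<close>

lemma cofactor_cong_one:
  fixes m :: int
  assumes "[a = 1] (mod m)" "[a * b = 1] (mod m)"
  shows "[b = 1] (mod m)"
  using cong_scalar_right[OF assms(1), of b] assms(2) cong_sym cong_trans by fastforce

lemma not_cong_one_uminus_one: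
  fixes m :: int
  assumes "m \<ge> 3"
  shows "\<not> [-1 = 1] (mod m)"
  using assms by (auto simp: cong_iff_dvd_diff dest: zdvd_imp_le)

lemma cong_one_nonzero:
  fixes m :: int
  assumes "m \<ge> 3" "[x = 1] (mod m)"
  shows "x \<noteq> 0"
  using assms by (auto simp: cong_iff_dvd_diff)

lemma cong_one_unit:
  fixes m :: int
  assumes "m \<ge> 3" "[x = 1] (mod m)" "x dvd 1"
  shows "x = 1"
  using assms not_cong_one_uminus_one[OF assms(1)] by (auto simp: zdvd1_eq abs_if split: if_splits)

lemma cong_one_coprime:
  fixes m :: int
  assumes "[x = 1] (mod m)"
  shows "coprime x m"
  using assms cong_imp_coprime cong_sym coprime_1_left by blast

text \<open>The usual cancellation argument: if \<open>x = a b\<close> divides \<open>a\<close>, then \<open>b\<close> is a unit.\<close>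

lemma one_mod_prime_imp_irreducible:
  assumes m: "m \<ge> 3" and x: "[x = 1] (mod m)" and prime: "one_mod_prime m x"
  shows "one_mod_irreducible m x"
proof -
  have *: "b = 1" if "[b = 1] (mod m)" "x = a * b" "x dvd a" for a b
  proof -
    have "a \<noteq> 0"
      using cong_one_nonzero[OF m x] that(2) by auto
    moreover have "a * b dvd a * 1"
      using that by simp
    ultimately have "b dvd 1"
      using dvd_mult_cancel_left[of a b 1] by blast
    with m that(1) show "b = 1"
      by (rule cong_one_unit)
  qed
  show ?thesis
    unfolding one_mod_irreducible_def
  proof (intro conjI allI impI)
    show "x \<noteq> 1" using prime by (simp add: one_mod_prime_def)
  next
    fix a b assume ab: "[a = 1] (mod m)" "[b = 1] (mod m)" "x = a * b"
    have "x dvd a * b" using ab(3) by simp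
    with ab(1,2) have "x dvd a \<or> x dvd b"
      using prime unfolding one_mod_prime_def by blast
    then show "a = 1 \<or> b = 1"
      using *[OF ab(2,3)] *[OF ab(1), of b] ab(3) by (metis mult.commute)
  qed
qed

section \<open>Few residue classes make irreducibles prime\<close>

text \<open>
  In an integer factorization \<open>x = a b\<close> the factor \<open>a\<close> is coprime to \<open>m\<close>, so \<open>a\<close> or \<open>-a\<close> lies
  in the monoid, and with it the cofactor \<open>b\<close> or \<open>-b\<close>. Thus \<open>x\<close> is irreducible, and hence
  prime, already as an integer.
\<close>

lemma one_mod_irreducible_imp_prime:
  fixes m :: int
  assumes m: "m \<ge> 3" and x: "[x = 1] (mod m)" and irred: "one_mod_irreducible m x"
    and pm1: "\<And>u. coprime u m \<Longrightarrow> [u = 1] (mod m) \<or> [u = -1] (mod m)"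
  shows "one_mod_prime m x"
proof -
  have "Factorial_Ring.irreducible x"
  proof (rule Factorial_Ring.irreducibleI)
    show "x \<noteq> 0" using m x by (rule cong_one_nonzero)
    show "\<not> x dvd 1"
      using cong_one_unit[OF m x] irred by (auto simp: one_mod_irreducible_def)
  next
    fix a b assume ab: "x = a * b"
    have "coprime a m"
      using cong_one_coprime[OF x] ab by simp
    then consider "[a = 1] (mod m)" | "[-a = 1] (mod m)"
      using pm1 cong_minus_minus_iff[of "a" "-1" m] by auto
    then show "a dvd 1 \<or> b dvd 1"
    proof cases
      case 1
      then have "[b = 1] (mod m)"
        using cofactor_cong_one x ab by blast
      with 1 ab irred have "a = 1 \<or> b = 1"
        by (simp add: one_mod_irreducible_def)
      then show ?thesis by auto
    next
      case 2
      then have "[-b = 1] (mod m)"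
        using cofactor_cong_one[of "-a" m "-b"] x ab by simp
      moreover have "x = -a * -b" using ab by simp
      ultimately have "-a = 1 \<or> -b = 1"
        using irred 2 unfolding one_mod_irreducible_def by blast
      then show ?thesis by (metis dvd_refl minus_dvd_iff)
    qed
  qed
  then have "prime_elem x" by (rule irreducible_imp_prime_elem)
  then show ?thesis
    using irred prime_elem_dvd_multD
    unfolding one_mod_prime_def one_mod_irreducible_def by blast
qed

section \<open>A further residue class yields an irreducible that is not prime\<close>

text \<open>
  The residues \<open>\<plusminus>1\<close> are closed under multiplication, so not all prime factors of \<open>u\<close> can have
  such a residue.
\<close>

lemma prime_not_cong_pm1:
  fixes m :: int
  assumes m: "m \<ge> 3" and u: "coprime u m" "\<not> [u = 1] (mod m)" "\<not> [u = -1] (mod m)"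
  shows "\<exists>p. Factorial_Ring.prime p \<and> coprime p m \<and> \<not> [p = 1] (mod m) \<and> \<not> [p = -1] (mod m)"
proof (rule ccontr)
  assume neg: "\<not> ?thesis"
  have "coprime u m \<longrightarrow> [u = 1] (mod m) \<or> [u = -1] (mod m)" for u
  proof (induction u rule: prime_divisors_induct)
    case zero
    then show ?case using m by auto
  next
    case (unit x)
    then have "x = 1 \<or> x = -1" by (auto simp: zdvd1_eq abs_if split: if_splits)
    then show ?case by auto
  next
    case (factor p x)
    show ?case
    proof
      assume "coprime (p * x) m"
      then have "[p = 1] (mod m) \<or> [p = -1] (mod m)" "[x = 1] (mod m) \<or> [x = -1] (mod m)"
        using neg factor by auto
      then show "[p * x = 1] (mod m) \<or> [p * x = -1] (mod m)"
        using cong_mult[of p _ m x] by fastforce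
    qed
  qed
  with u show False by blast
qed

text \<open>
  The exponent \<open>k\<close> is the order of \<open>p\<close> in \<open>(\<int>/m)\<^sup>\<times>/{\<plusminus>1}\<close>; Euler's theorem makes it finite.
\<close>

lemma least_power_cong_pm1:
  fixes m :: int
  assumes m: "m \<ge> 3" and p: "coprime p m" "\<not> [p = 1] (mod m)" "\<not> [p = -1] (mod m)"
  obtains k where "k \<ge> 2" "[p ^ k = 1] (mod m) \<or> [p ^ k = -1] (mod m)"
    "\<And>i. \<lbrakk>0 < i; i < k\<rbrakk> \<Longrightarrow> \<not> [p ^ i = 1] (mod m) \<and> \<not> [p ^ i = -1] (mod m)"
proof -
  define Q where "Q = (\<lambda>k. 0 < k \<and> ([p ^ k = 1] (mod m) \<or> [p ^ k = -1] (mod m)))"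
  define k where "k = (LEAST k. Q k)"
  interpret residues m "residue_ring m"
    using m by unfold_locales auto
  have "Q (totient (nat m))"
    using euler_theorem[OF p(1)] m by (auto simp: Q_def)
  then have "Q k" unfolding k_def by (rule LeastI)
  moreover have "k \<noteq> 1" using p \<open>Q k\<close> by (auto simp: Q_def)
  moreover have "\<not> Q i" if "i < k" for i
    using that unfolding k_def by (rule not_less_Least)
  ultimately show thesis
    by (intro that[of k]) (auto simp: Q_def)
qed

text \<open>
  The witness is \<open>\<plusminus>p^k\<close> with \<open>k\<close> the order above. Its divisors are \<open>\<plusminus>p^i\<close>, and of these only
  the ones with \<open>i = 0\<close> and \<open>i = k\<close> can lie in the monoid. Since \<open>k \<ge> 2\<close>, it divides the
  \<open>k\<close>-th power of a monoid element in which \<open>p\<close> occurs only once, but not that element.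
\<close>

lemma irreducible_not_prime_exists:
  fixes m :: int
  assumes m: "m \<ge> 3" and u: "coprime u m" "\<not> [u = 1] (mod m)" "\<not> [u = -1] (mod m)"
  shows "\<exists>x. [x = 1] (mod m) \<and> one_mod_irreducible m x \<and> \<not> one_mod_prime m x"
proof -
  obtain p where p: "Factorial_Ring.prime p" "coprime p m"
      "\<not> [p = 1] (mod m)" "\<not> [p = -1] (mod m)"
    using prime_not_cong_pm1[OF assms] by blast
  obtain k where k: "k \<ge> 2" "[p ^ k = 1] (mod m) \<or> [p ^ k = -1] (mod m)"
      "\<And>i. \<lbrakk>0 < i; i < k\<rbrakk> \<Longrightarrow> \<not> [p ^ i = 1] (mod m) \<and> \<not> [p ^ i = -1] (mod m)"
    using least_power_cong_pm1[OF m p(2-4)] by blast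
  define e :: int where "e = (if [p ^ k = 1] (mod m) then 1 else -1)"
  define x where "x = e * p ^ k"
  have e: "e = 1 \<or> e = -1" by (simp add: e_def)
  have x1: "[x = 1] (mod m)"
    using k(2) cong_minus_minus_iff[of "p ^ k" "-1" m] by (auto simp: x_def e_def)
  have x_unit: "\<not> x dvd 1"
  proof
    assume "x dvd 1"
    moreover have "p dvd x"
      using k(1) by (auto simp: x_def intro!: dvd_mult dvd_power)
    ultimately show False
      using p(1) dvd_trans not_prime_unit by blast
  qed
  have "one_mod_irreducible m x"
    unfolding one_mod_irreducible_def
  proof (intro conjI allI impI)
    show "x \<noteq> 1" using x_unit by auto
  next
    fix a b assume ab: "[a = 1] (mod m)" "[b = 1] (mod m)" "x = a * b"
    have "a dvd x" using ab(3) by simp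
    then have "a dvd p ^ k" using e by (auto simp: x_def)
    then obtain i where i: "i \<le> k" "normalize a = normalize (p ^ i)"
      using divides_primepow_weak[OF p(1)] by blast
    have a: "a = p ^ i \<or> a = - (p ^ i)"
      using i(2) by (auto simp: abs_eq_iff)
    then have "[p ^ i = 1] (mod m) \<or> [p ^ i = -1] (mod m)"
      using ab(1) cong_minus_minus_iff[of "p ^ i" "-1" m] by auto
    then have "i = 0 \<or> i = k" using k(3) i(1) by (metis le_neq_implies_less neq0_conv)
    then show "a = 1 \<or> b = 1"
    proof
      assume "i = 0"
      then show ?thesis using a cong_one_unit[OF m ab(1)] by auto
    next
      assume "i = k"
      then have "a * b dvd a * 1"
        using a e by (auto simp: x_def simp flip: ab(3))
      moreover have "a \<noteq> 0" using cong_one_nonzero[OF m ab(1)] .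
      ultimately have "b dvd 1"
        using dvd_mult_cancel_left[of a b 1] by blast
      then show ?thesis using cong_one_unit[OF m ab(2)] by blast
    qed
  qed
  moreover have "\<not> one_mod_prime m x"
  proof
    assume prime: "one_mod_prime m x"
    have power: "x dvd y" if "[y = 1] (mod m)" "x dvd y ^ j" for y j
      using that
    proof (induction j)
      case 0
      then show ?case using x_unit by simp
    next
      case (Suc j)
      have "[y ^ j = 1] (mod m)" using cong_pow[OF Suc.prems(1), of j] by simp
      then have "x dvd y \<or> x dvd y ^ j"
        using Suc.prems prime by (simp add: one_mod_prime_def)
      then show ?case using Suc by blast
    qed
    \<comment> \<open>An inverse of \<open>p\<close> modulo \<open>m\<close> that is not divisible by \<open>p\<close>: the second condition is
      imposed by asking for residue \<open>1\<close> modulo \<open>p\<close>.\<close>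
    obtain r where r: "[p * r = 1] (mod m)"
      using cong_solve_coprime_int[OF p(2)] by blast
    obtain q where q: "[q = r] (mod m)" "[q = 1] (mod p)"
      using binary_chinese_remainder_int[of m p r 1] p(2) by (auto simp: coprime_commute)
    have pq: "[p * q = 1] (mod m)"
      using cong_trans[OF cong_scalar_left[OF q(1)] r] .
    have "x dvd (p * q) ^ k"
      using e by (auto simp: x_def power_mult_distrib)
    with pq have "x dvd p * q" by (rule power)
    moreover have "p * p dvd x"
      using k(1) le_imp_power_dvd[of 2 k p] by (simp add: x_def power2_eq_square)
    ultimately have "p * p dvd p * q" using dvd_trans by blast
    then have "p dvd q" using p(1) by auto
    then have "p dvd 1" using cong_dvd_iff[OF q(2)] by simp
    then show False using p(1) not_prime_unit by blast
  qed
  ultimately show ?thesis using x1 by blast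
qed

section \<open>Transfer to the elliptic monoid\<close>

definition one_minus :: "nat \<Rightarrow> int \<Rightarrow> int" where
  "one_minus n a = 1 - (int n + 1) * a"

lemma one_minus_mult: "one_minus n (a \<otimes>\<^bsub>nEll n\<^esub> b) = one_minus n a * one_minus n b"
  by (simp add: one_minus_def nEll_def algebra_simps)

lemma one_minus_eq_iff [simp]: "one_minus n a = one_minus n b \<longleftrightarrow> a = b"
  by (simp add: one_minus_def)

lemma one_minus_eq_one_iff [simp]: "one_minus n a = 1 \<longleftrightarrow> a = 0"
  by (simp add: one_minus_def)

lemma one_minus_cong: "[one_minus n a = 1] (mod (int n + 1))"
  by (simp add: one_minus_def cong_iff_dvd_diff)

lemma one_minus_surj:
  assumes "[x = 1] (mod (int n + 1))"
  obtains a where "x = one_minus n a"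
proof -
  obtain a where "1 - x = (int n + 1) * a"
    using cong_sym[OF assms] by (auto simp: cong_iff_dvd_diff)
  then have "x = one_minus n a" by (simp add: one_minus_def)
  then show thesis by (rule that)
qed

lemma carrier_nEll [simp]: "carrier (nEll n) = UNIV"
  by (simp add: nEll_def)

lemma divides_nEll_iff: "a divides\<^bsub>nEll n\<^esub> b \<longleftrightarrow> one_minus n a dvd one_minus n b"
proof
  assume "a divides\<^bsub>nEll n\<^esub> b"
  then show "one_minus n a dvd one_minus n b"
    by (auto simp: factor_def one_minus_mult)
next
  assume "one_minus n a dvd one_minus n b"
  then obtain z where z: "one_minus n b = one_minus n a * z" ..
  then have "[z = 1] (mod (int n + 1))"
    using cofactor_cong_one one_minus_cong by metis
  then obtain c where "z = one_minus n c" by (rule one_minus_surj)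
  with z have "b = a \<otimes>\<^bsub>nEll n\<^esub> c"
    by (simp flip: one_minus_mult)
  then show "a divides\<^bsub>nEll n\<^esub> b" by (auto simp: factor_def)
qed

lemma Units_nEll:
  assumes "n \<ge> 2"
  shows "Units (nEll n) = {0}"
proof -
  interpret comm_monoid "nEll n" by (rule nEll_comm_monoid)
  have "a \<in> Units (nEll n) \<longleftrightarrow> a = 0" for a
  proof
    assume "a \<in> Units (nEll n)"
    then have "a divides\<^bsub>nEll n\<^esub> \<one>\<^bsub>nEll n\<^esub>"
      by (simp add: Unit_eq_dividesone)
    then have "one_minus n a dvd 1"
      by (simp add: divides_nEll_iff) (simp add: nEll_def one_minus_def)
    then have "one_minus n a = 1"
      using cong_one_unit[OF _ one_minus_cong] assms by simp
    then show "a = 0" by simp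
  next
    assume "a = 0"
    then show "a \<in> Units (nEll n)"
      using Units_one_closed by (simp add: nEll_def)
  qed
  then show ?thesis by blast
qed

text \<open>Turns quantification over the congruence class of \<open>1\<close> into quantification over \<open>\<int>\<close>.\<close>

lemma all_cong_one_iff:
  "(\<forall>x. [x = 1] (mod (int n + 1)) \<longrightarrow> P x) \<longleftrightarrow> (\<forall>a. P (one_minus n a))"
  by (metis one_minus_cong one_minus_surj)

lemma factor_irreducible_nEll_iff:
  assumes "n \<ge> 2"
  shows "factor_irreducible (nEll n) p \<longleftrightarrow> one_mod_irreducible (int n + 1) (one_minus n p)"
proof -
  have factorization: "p = a \<otimes>\<^bsub>nEll n\<^esub> b \<longleftrightarrow> one_minus n p = one_minus n a * one_minus n b" for a b
    by (simp flip: one_minus_mult)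
  show ?thesis
    unfolding factor_irreducible_def one_mod_irreducible_def Units_nEll[OF assms]
    by (simp add: all_cong_one_iff factorization)
qed

lemma prime_nEll_iff:
  assumes "n \<ge> 2"
  shows "Divisibility.prime (nEll n) p \<longleftrightarrow> one_mod_prime (int n + 1) (one_minus n p)"
  unfolding Divisibility.prime_def one_mod_prime_def Units_nEll[OF assms]
    divides_nEll_iff one_minus_mult
  by (simp add: all_cong_one_iff)

section \<open>The unit group modulo \<open>m\<close>\<close>

text \<open>
  For \<open>m \<ge> 3\<close> the classes of \<open>1\<close> and \<open>-1\<close>, represented by \<open>1\<close> and \<open>m - 1\<close>, are two distinct
  units, so already an equality of cardinalities with \<open>{\<plusminus>1}\<close> rules out any further unit.
\<close>

lemma units_residue_ring_iso_sign_iff: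
  fixes m :: int
  assumes m: "m \<ge> 3"
  shows "units_of (residue_ring m) \<cong> sign_img \<longleftrightarrow>
    (\<forall>u. coprime u m \<longrightarrow> [u = 1] (mod m) \<or> [u = -1] (mod m))"
proof -
  interpret residues m "residue_ring m"
    using m by unfold_locales auto
  let ?U = "Units (residue_ring m)"
  have units: "?U = {x. 0 < x \<and> x < m \<and> coprime x m}" by (rule res_units_eq)
  have pm1_units: "{1, m - 1} \<subseteq> ?U"
    using m by (auto simp: units coprime_diff_one_left)
  have mod_minus: "(-1) mod m = m - 1"
    using m by (simp add: zmod_minus1)
  have units_eq: "?U = {1, m - 1} \<longleftrightarrow>
    (\<forall>u. coprime u m \<longrightarrow> [u = 1] (mod m) \<or> [u = -1] (mod m))" (is "_ \<longleftrightarrow> ?R")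
  proof
    assume eq: "?U = {1, m - 1}"
    show ?R
    proof (intro allI impI)
      fix u assume "coprime u m"
      then have "u mod m \<in> ?U"
        using m by (simp add: mod_in_res_units)
      then show "[u = 1] (mod m) \<or> [u = -1] (mod m)"
        using m mod_minus by (auto simp: eq cong_def)
    qed
  next
    assume R: ?R
    have "x \<in> {1, m - 1}" if "x \<in> ?U" for x
      using that R[rule_format, of x] m mod_minus by (auto simp: units cong_def)
    with pm1_units show "?U = {1, m - 1}" by blast
  qed
  have "units_of (residue_ring m) \<cong> sign_img \<longleftrightarrow> ?U = {1, m - 1}"
  proof
    assume "units_of (residue_ring m) \<cong> sign_img"
    then obtain h where "bij_betw h ?U {-1, 1 :: int}"
      by (auto simp: is_iso_def iso_def units_of_carrier sign_img_def)
    then have "card ?U = 2" by (simp add: bij_betw_same_card)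
    then show "?U = {1, m - 1}"
      using card_subset_eq[OF _ pm1_units] m by (simp add: card_ge_0_finite)
  next
    assume eq: "?U = {1, m - 1}"
    define h :: "int \<Rightarrow> int" where "h x = (if x = 1 then 1 else -1)" for x
    have sq: "(m - 1) * (m - 1) mod m = 1"
    proof -
      have "(m - 1) * (m - 1) = 1 + m * (m - 2)" by (simp add: algebra_simps)
      then show ?thesis using m by simp
    qed
    have "h \<in> hom (units_of (residue_ring m)) sign_img"
      using m sq mod_minus by (auto simp: hom_def units_of_carrier units_of_mult eq sign_img_def h_def res_mult_eq)
    moreover have "bij_betw h ?U {-1, 1}"
      using m by (auto simp: bij_betw_def eq h_def)
    ultimately have "h \<in> iso (units_of (residue_ring m)) sign_img"
      by (simp add: iso_def units_of_carrier sign_img_def)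
    then show "units_of (residue_ring m) \<cong> sign_img" by (rule is_isoI)
  qed
  with units_eq show ?thesis by simp
qed

theorem proposition6p4:
  fixes n :: nat
  assumes "n \<ge> 2"
  shows "{p \<in> carrier (nEll n). factor_irreducible (nEll n) p}
           = {p \<in> carrier (nEll n). Divisibility.prime (nEll n) p}
         \<longleftrightarrow> units_of (residue_ring (int n + 1)) \<cong> sign_img"
proof -
  let ?m = "int n + 1"
  have m: "?m \<ge> 3" using assms by simp
  have "{p \<in> carrier (nEll n). factor_irreducible (nEll n) p}
           = {p \<in> carrier (nEll n). Divisibility.prime (nEll n) p} \<longleftrightarrow>
    (\<forall>p. one_mod_irreducible ?m (one_minus n p) \<longleftrightarrow> one_mod_prime ?m (one_minus n p))"
    by (auto simp: set_eq_iff factor_irreducible_nEll_iff prime_nEll_iff assms)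
  also have "\<dots> \<longleftrightarrow>
    (\<forall>x. [x = 1] (mod ?m) \<longrightarrow> one_mod_irreducible ?m x = one_mod_prime ?m x)"
    by (simp add: all_cong_one_iff)
  also have "\<dots> \<longleftrightarrow> (\<forall>u. coprime u ?m \<longrightarrow> [u = 1] (mod ?m) \<or> [u = -1] (mod ?m))"
    using one_mod_prime_imp_irreducible[OF m] one_mod_irreducible_imp_prime[OF m]
      irreducible_not_prime_exists[OF m] by blast
  also have "\<dots> \<longleftrightarrow> units_of (residue_ring ?m) \<cong> sign_img"
    using units_residue_ring_iso_sign_iff[OF m] by simp
  finally show ?thesis .
qed

end
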